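(* A distributive lattice $\mathbf L=\langle L,\sqcap,\sqcup,1\rangle$ (with top element $1$) is a classical implicative lattice if and only if it is a dual disjunctive lattice and for all $a,b\in L$ such that $b\in[a,1]$ there exists $b^*=\min\{x\in[a,1]: b\sqcup x=1\}$.
   Context: A classical implicative lattice is a relatively complemented distributive lattice with maximum $1$ (every element of every interval has a complement in that interval; equivalently, whenever $a\leq b$ there is $c\geq a$ with $b\sqcap c=a$ and $b\sqcup c=1$). A lattice $\langle L,\sqcap,\sqcup,1\rangle$ is dual disjunctive if it is distributive, has top element $1$, and for all $a,b\in L$ with $a>b$ there is $c\in L$ such that $a\sqcup c=1>b\sqcup c$. $[a,1]=\{x\in L: a\leq x\leq 1\}$. *)

theory Defs
  imports Main
begin

class relatively_complemented_lattice = lattice +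
  assumes relative_complement:
    "a \<le> x \<Longrightarrow> x \<le> b \<Longrightarrow>
      \<exists>c. a \<le> c \<and> c \<le> b \<and> inf x c = a \<and> sup x c = b"

class classical_implicative_lattice =
  relatively_complemented_lattice + distrib_lattice + order_top

class dual_disjunctive_lattice = distrib_lattice + order_top +
  assumes dual_disjunctive: "b < a \<Longrightarrow> \<exists>c. sup a c = top \<and> sup b c < top"

end

theory Submission imports Defs begin

text \<open>Both directions rest on b* being the complement of b in [a,1]. By distributivity such a
  complement lies below every x in [a,1] with b \<squnion> x = 1
  (\<open>complement_in_upper_interval_le\<close>), so relative complements supply the minima; if a
  > b, the complement of a in [b,1] witnesses dual disjunctivity. Conversely, dual disjunctivity
  forces the minimum b* to meet b in exactly a (\<open>least_cocomplement_is_complement\<close>).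
  Complements in [a,1] then yield complements in any [a,b] by meeting with b.\<close>

lemma complement_in_upper_interval_le:
  fixes a b c x :: "'a :: {distrib_lattice, order_top}"
  assumes "inf b c = a" "a \<le> x" "sup b x = top"
  shows "c \<le> x"
proof -
  have "c = inf c (sup b x)"
    using assms(3) by (simp add: inf_absorb1)
  also have "\<dots> = sup a (inf c x)"
    using assms(1) by (simp add: inf_sup_distrib1 inf_commute)
  also have "\<dots> \<le> x"
    using assms(2) by simp
  finally show ?thesis .
qed

text \<open>If x \<sqinter> m were strictly above a, dual disjunctivity would give c joining x
  \<sqinter> m, hence both x and m, to 1, but with a \<squnion> c < 1. Minimality of m, tested
  against a \<squnion> c, gives m \<le> a \<squnion> c, so 1 = m \<squnion> c \<le> a \<squnion> c,
  a contradiction.\<close>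

lemma least_cocomplement_is_complement:
  fixes a x m :: "'a :: {distrib_lattice, order_top}"
  assumes disj: "\<And>u v :: 'a. v < u \<Longrightarrow> \<exists>c. sup u c = top \<and> sup v c < top"
    and "a \<le> x" "a \<le> m"
    and least: "\<And>y. a \<le> y \<Longrightarrow> sup x y = top \<Longrightarrow> m \<le> y"
  shows "inf x m = a"
proof (rule ccontr)
  assume "inf x m \<noteq> a"
  then have "a < inf x m"
    using assms(2,3) by (simp add: less_le)
  then obtain c where c: "sup (inf x m) c = top" "sup a c < top"
    using disj by blast
  have "sup (inf x m) c \<le> sup x c" "sup (inf x m) c \<le> sup m c"
    by (simp_all add: le_supI1)
  then have "sup x c = top" "sup m c = top"
    using c(1) by (simp_all add: top_unique)
  then have "sup x (sup a c) = top"
    by (simp add: sup_left_commute sup_absorb2)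
  then have "m \<le> sup a c"
    by (intro least) simp_all
  then have "sup m c \<le> sup a c"
    by simp
  then show False
    using \<open>sup m c = top\<close> c(2) by simp
qed

theorem corollary5p3p4:
  "class.classical_implicative_lattice inf (\<le>) (<) sup (top :: 'a :: {distrib_lattice, order_top}) \<longleftrightarrow>
     class.dual_disjunctive_lattice inf (\<le>) (<) sup (top :: 'a) \<and>
     (\<forall>a b :: 'a. b \<in> {a..top} \<longrightarrow>
       (\<exists>m \<in> {x \<in> {a..top}. sup b x = top}. \<forall>x \<in> {x \<in> {a..top}. sup b x = top}. m \<le> x))"
  (is "?classical \<longleftrightarrow> ?disjunctive \<and> ?least")
proof
  assume ?classical
  then interpret classical_implicative_lattice inf "(\<le>)" "(<)" sup "top :: 'a" .
  have compl: "\<exists>c. a \<le> c \<and> inf b c = a \<and> sup b c = top" if "a \<le> b" for a b :: 'a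
    using relative_complement[OF that top_greatest] by blast
  have ?disjunctive
  proof unfold_locales
    fix a b :: 'a
    assume "b < a"
    \<comment> \<open>The witness is the complement of a in [b,1]. It is not 1, since otherwise a =
      a \<sqinter> c = b; and b \<squnion> c is just c.\<close>
    then obtain c where c: "b \<le> c" "inf a c = b" "sup a c = top"
      using compl[of b a] by (auto simp: less_imp_le)
    have "c \<noteq> top"
      using c(2) \<open>b < a\<close> by (metis inf_absorb1 top_greatest less_irrefl)
    with c show "\<exists>c. sup a c = top \<and> sup b c < top"
      by (auto simp: sup_absorb2 less_top[symmetric])
  qed
  moreover have ?least
  proof (intro allI impI)
    fix a b :: 'a
    assume "b \<in> {a..top}"
    then obtain c where c: "a \<le> c" "inf b c = a" "sup b c = top"
      using compl[of a b] by auto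
    have "c \<in> {x \<in> {a..top}. sup b x = top}"
      using c by simp
    moreover have "\<forall>x \<in> {x \<in> {a..top}. sup b x = top}. c \<le> x"
      using complement_in_upper_interval_le[OF c(2)] by simp
    ultimately show "\<exists>m \<in> {x \<in> {a..top}. sup b x = top}.
        \<forall>x \<in> {x \<in> {a..top}. sup b x = top}. m \<le> x" ..
  qed
  ultimately show "?disjunctive \<and> ?least" ..
next
  assume asm: "?disjunctive \<and> ?least"
  then interpret dual_disjunctive_lattice inf "(\<le>)" "(<)" sup "top :: 'a"
    by simp
  show ?classical
  proof unfold_locales
    fix a x b :: 'a
    assume "a \<le> x" "x \<le> b"
    then obtain m where m: "a \<le> m" "sup x m = top"
      and least: "\<And>y. a \<le> y \<Longrightarrow> sup x y = top \<Longrightarrow> m \<le> y"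
      using asm[THEN conjunct2, rule_format, of x a] by auto
    have "inf x m = a"
      using dual_disjunctive \<open>a \<le> x\<close> m(1) least by (rule least_cocomplement_is_complement)
    \<comment> \<open>Cutting m down to m \<sqinter> b moves the complement from [a,1] into [a,b].
      The meet with x is unchanged because x \<le> b.\<close>
    then have "inf x (inf m b) = a"
      using \<open>a \<le> x\<close> \<open>x \<le> b\<close> by (metis inf_assoc inf_absorb1 order_trans)
    \<comment> \<open>By distributivity the join is (x \<squnion> m) \<sqinter> (x \<squnion> b) = 1
      \<sqinter> b.\<close>
    moreover have "sup x (inf m b) = b"
      using m(2) \<open>x \<le> b\<close> by (simp add: sup_inf_distrib1 sup_absorb2 inf_absorb2)
    ultimately show "\<exists>c\<ge>a. c \<le> b \<and> inf x c = a \<and> sup x c = b"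
      using \<open>a \<le> x\<close> \<open>x \<le> b\<close> m(1) by (intro exI[of _ "inf m b"]) auto
  qed
qed

end
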